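(* Consider a country with a finite set of voters $H$, a finite set of political parties $T$, and a finite nonempty set of elections $L$. Each voter $h\in H$ has a fixed probability $p_h\in[0,1]$ of voting on any poll date and always votes for the same party $t(h)\in T$. Suppose that: (a) each election can be won by at most one party; and (b) for any turnout in any election, an extra vote for some party can neither decrease that party's win probability nor increase the win probability of a rival party. A sweep is an outcome in which one party wins all the elections. Let $\pi$ and $\pi'$ be two polling schedules such that $\pi$ is coarser than $\pi'$, i.e. any two elections that have the same poll date in $\pi'$ also have the same poll date in $\pi$. Then the probability of a sweep under schedule $\pi$ is greater than or equal to the probability of a sweep under schedule $\pi'$.
   Context: A polling schedule is a partition $\pi$ of $L$; two elections have the same poll date (are simultaneous) if they lie in the same part of $\pi$. Turnout: given a schedule $\pi$, for each voter $h$ and each part $M\in\pi$ (a poll date), $h$ turns out on that date with probability $p_h$, independently over all pairs $(h,M)$. If $h$ turns out on date $M$, then $h$ casts a vote for party $t(h)$ in every election $l\in M$; otherwise $h$ votes in no election $l\in M$. For $l\in L$ let $S_l\subseteq H$ be the (random) set of voters who vote in election $l$. Election outcomes: for each $l\in L$, $s\in T$ and $S\subseteq H$, let $f_{l,s}(S)\in[0,1]$ be the probability that party $s$ wins election $l$ when $S$ is the set of voters who voted in it (the outcome may be random, e.g. because ties are decided by coin tosses; it may also depend on the identities of the voters in $S$, and there may be no winner). Conditional on the sets $(S_l)_{l\in L}$, the outcomes of the different elections are independent. Condition (a) says that in each election at most one party wins, so $\sum_{s\in T} f_{l,s}(S)\le 1$. Condition (b) says that for all $l\in L$, $S\subseteq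 H$ and $h\in H$: $f_{l,t(h)}(S\cup\{h\})\ge f_{l,t(h)}(S)$, and $f_{l,s}(S\cup\{h\})\le f_{l,s}(S)$ for every $s\ne t(h)$. Thus the probability of a sweep under a given schedule is $\sum_{s\in T}\mathbb{E}\big[\prod_{l\in L} f_{l,s}(S_l)\big]$. *)

theory Defs
  imports "HOL-Probability.Probability"
begin

definition same_poll_date :: "'e set set \<Rightarrow> 'e \<Rightarrow> 'e \<Rightarrow> bool" where
  "same_poll_date \<pi> l l' \<longleftrightarrow> (\<exists>M\<in>\<pi>. l \<in> M \<and> l' \<in> M)"

definition coarser_schedule :: "'e set \<Rightarrow> 'e set set \<Rightarrow> 'e set set \<Rightarrow> bool" where
  "coarser_schedule L \<pi> \<pi>' \<longleftrightarrow>
     (\<forall>l\<in>L. \<forall>l'\<in>L. same_poll_date \<pi>' l l' \<longrightarrow> same_poll_date \<pi> l l')"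

text \<open>A turnout profile \<open>\<omega>\<close> records in \<open>\<omega> (h, M)\<close> whether voter \<open>h\<close> turns out on poll date \<open>M\<close>;
  these events are independent over all pairs.\<close>

definition turnout_pmf :: "'v set \<Rightarrow> ('v \<Rightarrow> real) \<Rightarrow> 'e set set \<Rightarrow> ('v \<times> 'e set \<Rightarrow> bool) pmf" where
  "turnout_pmf H p \<pi> = Pi_pmf (H \<times> \<pi>) False (\<lambda>(h, M). bernoulli_pmf (p h))"

definition voters :: "'v set \<Rightarrow> 'e set set \<Rightarrow> ('v \<times> 'e set \<Rightarrow> bool) \<Rightarrow> 'e \<Rightarrow> 'v set" where
  "voters H \<pi> \<omega> l = {h \<in> H. \<exists>M\<in>\<pi>. l \<in> M \<and> \<omega> (h, M)}"

text \<open>\<open>W l S\<close> is the law of the set of parties that win election \<open>l\<close> when exactly the voters in \<open>S\<close>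
  have voted in it; the empty set means that there is no winner. The party voted for by each voter
  is not an argument, since \<open>W\<close> may depend on the identities of the voters.\<close>

definition win_prob :: "('e \<Rightarrow> 'v set \<Rightarrow> 'p set pmf) \<Rightarrow> 'e \<Rightarrow> 'p \<Rightarrow> 'v set \<Rightarrow> real" where
  "win_prob W l s S = measure_pmf.prob (W l S) {A. s \<in> A}"

text \<open>The joint law of the winner sets of all elections: the turnout is drawn first, and given the
  turnout the elections are independent.\<close>

definition outcome_pmf ::
  "'v set \<Rightarrow> 'e set \<Rightarrow> ('v \<Rightarrow> real) \<Rightarrow> ('e \<Rightarrow> 'v set \<Rightarrow> 'p set pmf) \<Rightarrow> 'e set set \<Rightarrow> ('e \<Rightarrow> 'p set) pmf" where
  "outcome_pmf H L p W \<pi> =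
     bind_pmf (turnout_pmf H p \<pi>) (\<lambda>\<omega>. Pi_pmf L {} (\<lambda>l. W l (voters H \<pi> \<omega> l)))"

definition sweep :: "'p set \<Rightarrow> 'e set \<Rightarrow> ('e \<Rightarrow> 'p set) set" where
  "sweep T L = {w. \<exists>s\<in>T. \<forall>l\<in>L. s \<in> w l}"

definition sweep_prob ::
  "'v set \<Rightarrow> 'p set \<Rightarrow> 'e set \<Rightarrow> ('v \<Rightarrow> real) \<Rightarrow> ('e \<Rightarrow> 'v set \<Rightarrow> 'p set pmf) \<Rightarrow> 'e set set \<Rightarrow> real" where
  "sweep_prob H T L p W \<pi> = measure_pmf.prob (outcome_pmf H L p W \<pi>) (sweep T L)"

lemma sweep_prob_eq_sum_expectation:
  assumes "finite T" and "finite L" and "L \<noteq> {}"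
    and parties: "\<And>l S A. l \<in> L \<Longrightarrow> S \<subseteq> H \<Longrightarrow> A \<in> set_pmf (W l S) \<Longrightarrow> A \<subseteq> T"
    and at_most_one: "\<And>l S A. l \<in> L \<Longrightarrow> S \<subseteq> H \<Longrightarrow> A \<in> set_pmf (W l S) \<Longrightarrow> card A \<le> 1"
  shows "sweep_prob H T L p W \<pi> =
    (\<Sum>s\<in>T. measure_pmf.expectation (turnout_pmf H p \<pi>)
              (\<lambda>\<omega>. \<Prod>l\<in>L. win_prob W l s (voters H \<pi> \<omega> l)))"
proof -
  let ?N = "\<lambda>\<omega>. Pi_pmf L {} (\<lambda>l. W l (voters H \<pi> \<omega> l))"
  let ?E = "\<lambda>s. Pi L (\<lambda>_. {A. s \<in> A})"
  have voters_sub: "voters H \<pi> \<omega> l \<subseteq> H" for \<omega> l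
    by (auto simp: voters_def)
  obtain l0 where l0: "l0 \<in> L"
    using \<open>L \<noteq> {}\<close> by blast
  have law: "measure_pmf.prob (outcome_pmf H L p W \<pi>) X =
      measure_pmf.expectation (turnout_pmf H p \<pi>) (\<lambda>\<omega>. measure_pmf.prob (?N \<omega>) X)" for X
    unfolding outcome_pmf_def measure_pmf_bind
    by (rule measure_pmf.measure_bind[where N = "count_space UNIV"])
      (auto simp: measure_pmf_in_subprob_algebra)
  have event: "sweep T L = (\<Union>s\<in>T. ?E s)"
    by (auto simp: sweep_def)
  have unique: "s = s'"
    if w: "w \<in> set_pmf (outcome_pmf H L p W \<pi>)" "s \<in> w l0" "s' \<in> w l0" for w s s'
  proof -
    obtain \<omega> where "w \<in> set_pmf (?N \<omega>)"
      using w(1) by (auto simp: outcome_pmf_def)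
    then have "w l0 \<in> set_pmf (W l0 (voters H \<pi> \<omega> l0))"
      using l0 \<open>finite L\<close> by (auto simp: set_Pi_pmf PiE_dflt_def)
    then have "w l0 \<subseteq> T" "card (w l0) \<le> 1"
      using parties[OF l0 voters_sub] at_most_one[OF l0 voters_sub] by blast+
    then show "s = s'"
      using w(2,3) \<open>finite T\<close> by (metis card_le_Suc0_iff_eq finite_subset One_nat_def)
  qed
  have "sweep_prob H T L p W \<pi> = (\<Sum>s\<in>T. measure_pmf.prob (outcome_pmf H L p W \<pi>) (?E s))"
  proof -
    let ?D = "outcome_pmf H L p W \<pi>"
    have "measure_pmf.prob ?D (\<Union>s\<in>T. ?E s) = measure_pmf.prob ?D (\<Union>s\<in>T. ?E s \<inter> set_pmf ?D)"
      by (subst measure_Int_set_pmf[symmetric]) (simp add: Int_UN_distrib2)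
    also have "\<dots> = (\<Sum>s\<in>T. measure_pmf.prob ?D (?E s \<inter> set_pmf ?D))"
    proof (rule measure_pmf.finite_measure_finite_Union)
      show "disjoint_family_on (\<lambda>s. ?E s \<inter> set_pmf ?D) T"
        unfolding disjoint_family_on_def using unique l0 by (fastforce simp: Pi_def)
    qed (use \<open>finite T\<close> in auto)
    also have "\<dots> = (\<Sum>s\<in>T. measure_pmf.prob ?D (?E s))"
      by (simp add: measure_Int_set_pmf)
    finally show ?thesis
      unfolding sweep_prob_def event .
  qed
  also have "\<dots> = (\<Sum>s\<in>T. measure_pmf.expectation (turnout_pmf H p \<pi>)
              (\<lambda>\<omega>. \<Prod>l\<in>L. win_prob W l s (voters H \<pi> \<omega> l)))"
    by (simp add: law measure_Pi_pmf_Pi[OF \<open>finite L\<close>] win_prob_def)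
  finally show ?thesis .
qed

end

theory Submission
  imports Defs
begin

text \<open>
  Since no election has two winners, the probability of a sweep is the sum over the parties \<open>s\<close> of
  the probability that \<open>s\<close> wins everything, and the inequality holds for each \<open>s\<close> separately.  Fix \<open>s\<close>.  Different poll dates
  have independent turnouts, all with the same law: that of a random set of voters containing each
  \<open>h\<close> independently with probability \<open>p h\<close>.  Hence the probability that \<open>s\<close> wins everything is a
  product over the dates \<open>M\<close> of the expectation, for one such random set, of the product of the
  win probabilities of \<open>s\<close> in the elections of \<open>M\<close> (lemma \<open>expectation_schedule\<close>).

  Making the schedule coarser merges groups of dates, so it replaces a product of expectations by
  the expectation of the product.  This can only increase the value, because the factors are
  positively correlated: none of them decreases when another supporter of \<open>s\<close> turns out, and
  none increases when anybody else does.  All factors are thus monotone in each voter's turnout, in a direction that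
  depends on the voter but not on the factor, and Harris's inequality applies
  (lemmas \<open>Harris_inequality\<close> and \<open>Harris_inequality_prod\<close>).
\<close>

section \<open>Positive correlation of monotone functions\<close>

text \<open>Chebyshev's association inequality: if \<open>X\<close> and \<open>Y\<close> are independent with law \<open>q\<close>, then
  twice the covariance of \<open>f X\<close> and \<open>g X\<close> is the expectation of
  \<open>(f X - f Y) * (g X - g Y)\<close>, which is nonnegative pointwise.\<close>

lemma expectation_comonotone_mult:
  fixes f g :: "'b \<Rightarrow> real"
  assumes fin: "finite (set_pmf q)"
    and comonotone: "\<And>a b. (f a - f b) * (g a - g b) \<ge> 0"
  shows "measure_pmf.expectation q f * measure_pmf.expectation q g
           \<le> measure_pmf.expectation q (\<lambda>a. f a * g a)"
proof -
  let ?A = "set_pmf q"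
  have E: "measure_pmf.expectation q k = (\<Sum>a\<in>?A. pmf q a * k a)" for k :: "'b \<Rightarrow> real"
    using integral_measure_pmf[OF fin, of q k] by simp
  have total: "(\<Sum>a\<in>?A. pmf q a) = 1"
    by (rule sum_pmf_eq_1[OF fin]) simp
  let ?Ef = "\<Sum>a\<in>?A. pmf q a * f a"
  let ?Eg = "\<Sum>a\<in>?A. pmf q a * g a"
  let ?Efg = "\<Sum>a\<in>?A. pmf q a * (f a * g a)"
  have "0 \<le> (\<Sum>a\<in>?A. \<Sum>b\<in>?A. pmf q a * pmf q b * ((f a - f b) * (g a - g b)))"
    by (intro sum_nonneg mult_nonneg_nonneg comonotone) auto
  also have "\<dots> = (\<Sum>a\<in>?A. \<Sum>b\<in>?A. pmf q a * (f a * g a) * pmf q b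
      - pmf q a * f a * (pmf q b * g b) - pmf q a * g a * (pmf q b * f b)
      + pmf q a * (pmf q b * (f b * g b)))"
    by (intro sum.cong refl) (simp add: algebra_simps)
  also have "\<dots> = ?Efg * (\<Sum>a\<in>?A. pmf q a) - ?Ef * ?Eg - ?Eg * ?Ef + (\<Sum>a\<in>?A. pmf q a) * ?Efg"
    by (simp only: sum_product sum.distrib sum_subtractf)
  finally show ?thesis
    unfolding E total by simp
qed

lemma expectation_Pi_pmf_insert:
  fixes f :: "('i \<Rightarrow> 'b) \<Rightarrow> real"
  assumes "finite A" "i \<notin> A"
    and fin: "finite (set_pmf (q i))" "finite (set_pmf (Pi_pmf A d q))"
  shows "measure_pmf.expectation (Pi_pmf (insert i A) d q) f =
    measure_pmf.expectation (q i)
      (\<lambda>a. measure_pmf.expectation (Pi_pmf A d q) (\<lambda>x. f (x(i := a))))"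
proof -
  have "Pi_pmf (insert i A) d q =
      q i \<bind> (\<lambda>a. map_pmf (\<lambda>x. x(i := a)) (Pi_pmf A d q))"
    using assms(1,2) by (simp add: Pi_pmf_insert' map_pmf_def)
  then show ?thesis
    using fin by (simp add: pmf_expectation_bind[OF fin(1)] integral_measure_pmf[OF fin(1)])
qed

lemma finite_set_Pi_pmf:
  assumes "finite A" "\<And>i. i \<in> A \<Longrightarrow> finite (set_pmf (q i))"
  shows "finite (set_pmf (Pi_pmf A d q))"
  using assms by (auto simp: set_Pi_pmf)

text \<open>The relation that compares two values of a coordinate may depend on the coordinate.  This
  makes room for functions that increase in some coordinates and decrease in others.\<close>

definition coordinatewise_mono ::
  "'i set \<Rightarrow> ('i \<Rightarrow> 'b \<Rightarrow> 'b \<Rightarrow> bool) \<Rightarrow> (('i \<Rightarrow> 'b) \<Rightarrow> real) \<Rightarrow> bool" where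
  "coordinatewise_mono A le f \<longleftrightarrow>
     (\<forall>x. \<forall>i\<in>A. \<forall>a b. le i a b \<longrightarrow> f (x(i := a)) \<le> f (x(i := b)))"

lemma coordinatewise_monoD:
  "coordinatewise_mono A le f \<Longrightarrow> i \<in> A \<Longrightarrow> le i a b \<Longrightarrow> f (x(i := a)) \<le> f (x(i := b))"
  by (auto simp: coordinatewise_mono_def)

lemma coordinatewise_mono_prod:
  assumes "\<And>k. k \<in> K \<Longrightarrow> coordinatewise_mono A le (f k)"
    and "\<And>k x. k \<in> K \<Longrightarrow> 0 \<le> f k x"
  shows "coordinatewise_mono A le (\<lambda>x. \<Prod>k\<in>K. f k x)"
  unfolding coordinatewise_mono_def
proof (intro allI ballI impI)
  fix x i a b assume "i \<in> A" "le i a b"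
  then show "(\<Prod>k\<in>K. f k (x(i := a))) \<le> (\<Prod>k\<in>K. f k (x(i := b)))"
    using assms(2) coordinatewise_monoD[OF assms(1)] by (intro prod_mono conjI) blast+
qed

text \<open>Harris's inequality, one coordinate at a time.  Conditionally on coordinate \<open>i\<close> the claim holds
  by induction; the two conditional expectations are functions of coordinate \<open>i\<close> alone and monotone
  in the same direction, so that Chebyshev's inequality combines them.  Comparability of any two
  values is what makes such functions comonotone.\<close>

lemma Harris_inequality:
  fixes f g :: "('i \<Rightarrow> 'b) \<Rightarrow> real"
  assumes "finite A"
    and "\<And>i. i \<in> A \<Longrightarrow> finite (set_pmf (q i))"
    and "\<And>i a b. i \<in> A \<Longrightarrow> le i a b \<or> le i b a"
    and "coordinatewise_mono A le f" "coordinatewise_mono A le g"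
  shows "measure_pmf.expectation (Pi_pmf A d q) f * measure_pmf.expectation (Pi_pmf A d q) g
           \<le> measure_pmf.expectation (Pi_pmf A d q) (\<lambda>x. f x * g x)"
  using assms
proof (induction A arbitrary: f g rule: finite_induct)
  case empty
  show ?case by simp
next
  case (insert i A)
  let ?E = "measure_pmf.expectation (Pi_pmf A d q)"
  define F where "F k a = ?E (\<lambda>x. k (x(i := a)))" for k :: "('i \<Rightarrow> 'b) \<Rightarrow> real" and a
  have fin_i: "finite (set_pmf (q i))" and fin_A: "finite (set_pmf (Pi_pmf A d q))"
    using insert.prems(1) insert.hyps by (auto intro!: finite_set_Pi_pmf)
  have split: "measure_pmf.expectation (Pi_pmf (insert i A) d q) k = measure_pmf.expectation (q i) (F k)"
    for k
    unfolding F_def using insert.hyps fin_i fin_A by (rule expectation_Pi_pmf_insert)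
  have section_mono: "coordinatewise_mono A le (\<lambda>x. k (x(i := a)))"
    if "coordinatewise_mono (insert i A) le k" for k a
    unfolding coordinatewise_mono_def
  proof (intro allI ballI impI)
    fix x j b c assume "j \<in> A" "le j b c"
    moreover from this have "j \<noteq> i" using insert.hyps by auto
    ultimately show "k (x(j := b, i := a)) \<le> k (x(j := c, i := a))"
      using coordinatewise_monoD[OF that, of j b c "x(i := a)"]
      by (simp add: fun_upd_twist)
  qed
  have F_mono: "F k a \<le> F k b" if "coordinatewise_mono (insert i A) le k" "le i a b" for k a b
    unfolding F_def using that
    by (intro integral_mono integrable_measure_pmf_finite fin_A) (auto dest: coordinatewise_monoD)
  have F_diff_sign: "(F f a - F f b) * (F g a - F g b) \<ge> 0" for a b
    using insert.prems(2)[of i a b] F_mono[OF insert.prems(3)] F_mono[OF insert.prems(4)]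
    by (auto intro: mult_nonneg_nonneg mult_nonpos_nonpos)
  have "measure_pmf.expectation (q i) (F f) * measure_pmf.expectation (q i) (F g)
      \<le> measure_pmf.expectation (q i) (\<lambda>a. F f a * F g a)"
    by (rule expectation_comonotone_mult[OF fin_i F_diff_sign])
  also have "\<dots> \<le> measure_pmf.expectation (q i) (F (\<lambda>x. f x * g x))"
  proof (intro integral_mono integrable_measure_pmf_finite fin_i)
    fix a
    show "F f a * F g a \<le> F (\<lambda>x. f x * g x) a"
      unfolding F_def
      by (rule insert.IH[OF _ _ section_mono section_mono]) (use insert.prems in auto)
  qed
  finally show ?case
    unfolding split .
qed

lemma Harris_inequality_prod:
  fixes f :: "'k \<Rightarrow> ('i \<Rightarrow> 'b) \<Rightarrow> real"
  assumes "finite A"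
    and fin: "\<And>i. i \<in> A \<Longrightarrow> finite (set_pmf (q i))"
    and total: "\<And>i a b. i \<in> A \<Longrightarrow> le i a b \<or> le i b a"
    and "finite K"
    and "\<And>k. k \<in> K \<Longrightarrow> coordinatewise_mono A le (f k)"
    and "\<And>k x. k \<in> K \<Longrightarrow> 0 \<le> f k x"
  shows "(\<Prod>k\<in>K. measure_pmf.expectation (Pi_pmf A d q) (f k))
           \<le> measure_pmf.expectation (Pi_pmf A d q) (\<lambda>x. \<Prod>k\<in>K. f k x)"
  using assms(4-)
proof (induction K rule: finite_induct)
  case empty
  show ?case by simp
next
  case (insert k K)
  let ?E = "measure_pmf.expectation (Pi_pmf A d q)"
  have "?E (f k) * (\<Prod>j\<in>K. ?E (f j)) \<le> ?E (f k) * ?E (\<lambda>x. \<Prod>j\<in>K. f j x)"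
    using insert.prems by (intro mult_left_mono insert.IH Bochner_Integration.integral_nonneg) auto
  also have "\<dots> \<le> ?E (\<lambda>x. f k x * (\<Prod>j\<in>K. f j x))"
    using insert.prems
    by (intro Harris_inequality[where le = le] coordinatewise_mono_prod assms(1-3)) auto
  finally show ?case
    using insert.hyps by simp
qed

section \<open>Independence of the poll dates\<close>

text \<open>Currying: reading the turnout date by date is what turns it into an independent family of
  electorates, one for each date.\<close>

lemma Pi_pmf_times:
  fixes q :: "'a \<Rightarrow> 'c \<Rightarrow> 'b pmf"
  assumes "finite A" "finite B"
  shows "Pi_pmf (A \<times> B) d (\<lambda>(a, b). q a b) =
    map_pmf (\<lambda>F (a, b). F b a) (Pi_pmf B (\<lambda>_. d) (\<lambda>b. Pi_pmf A d (\<lambda>a. q a b)))"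
    (is "?P = map_pmf ?u ?R")
proof (rule pmf_eqI)
  fix x :: "'a \<times> 'c \<Rightarrow> 'b"
  define F where "F b a = x (a, b)" for b a
  have x: "x = ?u F"
    by (auto simp: F_def)
  have "inj ?u"
    by (rule injI) (auto simp: fun_eq_iff)
  then have "pmf (map_pmf ?u ?R) x = pmf ?R F"
    unfolding x by (rule pmf_map_inj')
  also have "\<dots> = pmf ?P x"
  proof (cases "\<forall>z. z \<notin> A \<times> B \<longrightarrow> x z = d")
    case True
    then have "pmf ?R F = (\<Prod>b\<in>B. pmf (Pi_pmf A d (\<lambda>a. q a b)) (F b))"
      using assms by (intro pmf_Pi') (auto simp: F_def)
    also have "\<dots> = (\<Prod>b\<in>B. \<Prod>a\<in>A. pmf (q a b) (x (a, b)))"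
      using assms True by (intro prod.cong refl) (simp add: pmf_Pi' F_def)
    also have "\<dots> = (\<Prod>a\<in>A. \<Prod>b\<in>B. pmf (q a b) (x (a, b)))"
      by (rule prod.swap)
    also have "\<dots> = pmf ?P x"
      using assms True
      by (subst pmf_Pi') (auto simp: prod.cartesian_product intro: prod.cong)
    finally show ?thesis .
  next
    case False
    then obtain a b where ab: "(a, b) \<notin> A \<times> B" "x (a, b) \<noteq> d"
      by auto
    have "pmf ?R F = 0"
    proof (cases "b \<in> B")
      case True
      then have "pmf (Pi_pmf A d (\<lambda>a. q a b)) (F b) = 0"
        using ab assms by (intro pmf_Pi_outside) (auto simp: F_def)
      then have "(\<Prod>b\<in>B. pmf (Pi_pmf A d (\<lambda>a. q a b)) (F b)) = 0"
        using True assms by (intro prod_zero) auto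
      then show ?thesis
        by (simp add: pmf_Pi[OF assms(2)])
    next
      case False
      then show ?thesis
        using ab assms by (intro pmf_Pi_outside) (auto simp: F_def fun_eq_iff)
    qed
    moreover have "pmf ?P x = 0"
      using ab assms by (intro pmf_Pi_outside) auto
    ultimately show ?thesis by simp
  qed
  finally show "pmf ?P x = pmf (map_pmf ?u ?R) x" ..
qed

text \<open>Every election belongs to exactly one date and depends only on the turnout of that date.  On
  the right-hand side the dates share one law, which no longer mentions the schedule: this is what
  makes different schedules comparable.\<close>

lemma expectation_schedule:
  fixes g :: "'e \<Rightarrow> 'v set \<Rightarrow> real"
  assumes "finite H" "finite L" and part: "partition_on L \<pi>"
    and nonneg: "\<And>l S. 0 \<le> g l S"
  shows "measure_pmf.expectation (turnout_pmf H p \<pi>) (\<lambda>\<omega>. \<Prod>l\<in>L. g l (voters H \<pi> \<omega> l)) =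
    (\<Prod>M\<in>\<pi>. measure_pmf.expectation (Pi_pmf H False (\<lambda>h. bernoulli_pmf (p h)))
              (\<lambda>x. \<Prod>l\<in>M. g l {h \<in> H. x h}))"
proof -
  let ?Q = "Pi_pmf H False (\<lambda>h. bernoulli_pmf (p h))"
  have fin: "finite \<pi>"
    using finite_elements[OF \<open>finite L\<close> part] .
  have law: "turnout_pmf H p \<pi> = map_pmf (\<lambda>F (h, M). F M h) (Pi_pmf \<pi> (\<lambda>_. False) (\<lambda>_. ?Q))"
    unfolding turnout_pmf_def using \<open>finite H\<close> fin by (rule Pi_pmf_times)
  have voters: "voters H \<pi> \<omega> l = {h \<in> H. \<omega> (h, M)}" if "M \<in> \<pi>" "l \<in> M" for \<omega> l M
  proof -
    have "M' = M" if "M' \<in> \<pi>" "l \<in> M'" for M'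
      using partition_onD2[OF part] \<open>M \<in> \<pi>\<close> \<open>l \<in> M\<close> that by (auto simp: disjoint_def)
    then show ?thesis
      unfolding voters_def using that by blast
  qed
  have "(\<Prod>l\<in>L. g l (voters H \<pi> \<omega> l)) = (\<Prod>M\<in>\<pi>. \<Prod>l\<in>M. g l {h \<in> H. \<omega> (h, M)})" for \<omega>
    unfolding prod.partition[OF \<open>finite L\<close> part]
    by (intro prod.cong refl) (simp add: voters)
  then have "measure_pmf.expectation (turnout_pmf H p \<pi>) (\<lambda>\<omega>. \<Prod>l\<in>L. g l (voters H \<pi> \<omega> l)) =
      measure_pmf.expectation (Pi_pmf \<pi> (\<lambda>_. False) (\<lambda>_. ?Q))
        (\<lambda>F. \<Prod>M\<in>\<pi>. \<Prod>l\<in>M. g l {h \<in> H. F M h})"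
    by (simp add: law)
  also have "\<dots> = (\<Prod>M\<in>\<pi>. measure_pmf.expectation ?Q (\<lambda>x. \<Prod>l\<in>M. g l {h \<in> H. x h}))"
    using \<open>finite H\<close> fin nonneg
    by (intro expectation_prod_Pi_pmf integrable_measure_pmf_finite finite_set_Pi_pmf)
      (auto intro: prod_nonneg)
  finally show ?thesis .
qed

section \<open>Comparing two schedules\<close>

lemma coarser_schedule_part_subset:
  assumes part: "partition_on L \<pi>" and part': "partition_on L \<pi>'"
    and coarser: "coarser_schedule L \<pi> \<pi>'" and "M' \<in> \<pi>'"
  shows "\<exists>M\<in>\<pi>. M' \<subseteq> M"
proof -
  have "M' \<subseteq> L"
    using part' \<open>M' \<in> \<pi>'\<close> by (auto dest: partition_onD1)
  have "M' \<noteq> {}"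
    using partition_onD3[OF part'] \<open>M' \<in> \<pi>'\<close> by metis
  then obtain l where l: "l \<in> M'"
    by blast
  then obtain M where M: "M \<in> \<pi>" "l \<in> M"
    using part \<open>M' \<subseteq> L\<close> by (auto dest: partition_onD1)
  have "k \<in> M" if "k \<in> M'" for k
  proof -
    have "same_poll_date \<pi> l k"
      using coarser l that \<open>M' \<in> \<pi>'\<close> \<open>M' \<subseteq> L\<close>
      by (auto simp: coarser_schedule_def same_poll_date_def)
    then obtain N where "N \<in> \<pi>" "l \<in> N" "k \<in> N"
      by (auto simp: same_poll_date_def)
    with M partition_onD2[OF part] show "k \<in> M"
      by (auto simp: disjoint_def)
  qed
  with M show ?thesis by auto
qed

text \<open>Each part of \<open>\<pi>\<close> is the disjoint union of the parts of \<open>\<pi>'\<close> inside it, so Harris's inequality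
  can be applied within each part of \<open>\<pi>\<close>.\<close>

lemma expectation_coarser_schedule:
  fixes g :: "'e \<Rightarrow> 'v set \<Rightarrow> real"
  assumes "finite H" "finite L"
    and part: "partition_on L \<pi>" and part': "partition_on L \<pi>'"
    and coarser: "coarser_schedule L \<pi> \<pi>'"
    and nonneg: "\<And>l S. 0 \<le> g l S"
    and total: "\<And>h a b. h \<in> H \<Longrightarrow> le h a b \<or> le h b a"
    and mono: "\<And>l. l \<in> L \<Longrightarrow> coordinatewise_mono H le (\<lambda>x. g l {h \<in> H. x h})"
  shows "measure_pmf.expectation (turnout_pmf H p \<pi>') (\<lambda>\<omega>. \<Prod>l\<in>L. g l (voters H \<pi>' \<omega> l))
    \<le> measure_pmf.expectation (turnout_pmf H p \<pi>) (\<lambda>\<omega>. \<Prod>l\<in>L. g l (voters H \<pi> \<omega> l))"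
proof -
  let ?E = "measure_pmf.expectation (Pi_pmf H False (\<lambda>h. bernoulli_pmf (p h)))"
  define G where "G M x = (\<Prod>l\<in>M. g l {h \<in> H. x h})" for M x
  define sub where "sub M = {M' \<in> \<pi>'. M' \<subseteq> M}" for M
  have fin: "finite \<pi>" and fin': "finite \<pi>'"
    using finite_elements \<open>finite L\<close> part part' by blast+
  have G_nonneg: "0 \<le> G M x" for M x
    unfolding G_def by (intro prod_nonneg nonneg ballI)
  have sub_UN: "\<pi>' = (\<Union>M\<in>\<pi>. sub M)"
    using coarser_schedule_part_subset[OF part part' coarser] by (auto simp: sub_def)
  have parts_subset: "M \<subseteq> L" if "M \<in> \<pi>" for M
    using part that by (auto dest: partition_onD1)
  have sub_disjoint: "sub M \<inter> sub N = {}" if "M \<in> \<pi>" "N \<in> \<pi>" "M \<noteq> N" for M N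
  proof -
    have "M \<inter> N = {}"
      using partition_onD2[OF part] that by (auto simp: disjoint_def)
    then have "K = {}" if "K \<in> sub M" "K \<in> sub N" for K
      using that by (auto simp: sub_def)
    then show ?thesis
      using partition_onD3[OF part'] unfolding sub_def by blast
  qed
  have sub_partition: "partition_on M (sub M)" if M: "M \<in> \<pi>" for M
  proof (rule partition_onI)
    show "\<Union>(sub M) = M"
    proof
      show "M \<subseteq> \<Union>(sub M)"
      proof
        fix l assume "l \<in> M"
        then obtain M' where M': "M' \<in> \<pi>'" "l \<in> M'"
          using M parts_subset part' by (blast dest: partition_onD1)
        obtain N where "N \<in> \<pi>" "M' \<subseteq> N"
          using coarser_schedule_part_subset[OF part part' coarser M'(1)] by auto
        moreover have "N = M"
          using partition_onD2[OF part] calculation M M' \<open>l \<in> M\<close> by (auto simp: disjoint_def)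
        ultimately show "l \<in> \<Union>(sub M)"
          using M' by (auto simp: sub_def)
      qed
    qed (auto simp: sub_def)
  qed (use partition_onD2[OF part'] partition_onD3[OF part'] in
      \<open>auto simp: sub_def disjoint_def disjnt_def\<close>)
  have "measure_pmf.expectation (turnout_pmf H p \<pi>') (\<lambda>\<omega>. \<Prod>l\<in>L. g l (voters H \<pi>' \<omega> l))
      = (\<Prod>M'\<in>\<pi>'. ?E (G M'))"
    unfolding G_def using \<open>finite H\<close> \<open>finite L\<close> part' nonneg by (rule expectation_schedule)
  also have "\<dots> = (\<Prod>M\<in>\<pi>. \<Prod>M'\<in>sub M. ?E (G M'))"
    unfolding sub_UN using fin fin' sub_disjoint
    by (subst prod.UNION_disjoint) (auto simp: sub_def)
  also have "\<dots> \<le> (\<Prod>M\<in>\<pi>. ?E (G M))"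
  proof (rule prod_mono, safe)
    fix M assume M: "M \<in> \<pi>"
    show "0 \<le> (\<Prod>M'\<in>sub M. ?E (G M'))"
      by (intro prod_nonneg ballI Bochner_Integration.integral_nonneg G_nonneg)
    have "(\<Prod>M'\<in>sub M. ?E (G M')) \<le> ?E (\<lambda>x. \<Prod>M'\<in>sub M. G M' x)"
    proof (rule Harris_inequality_prod[where le = le])
      fix M' assume "M' \<in> sub M"
      then have "M' \<subseteq> L"
        using M parts_subset by (auto simp: sub_def)
      then show "coordinatewise_mono H le (G M')"
        unfolding G_def by (intro coordinatewise_mono_prod mono nonneg) auto
    qed (use \<open>finite H\<close> fin' total G_nonneg in \<open>auto simp: sub_def\<close>)
    also have "(\<lambda>x. \<Prod>M'\<in>sub M. G M' x) = G M"
      unfolding G_def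
      using finite_subset[OF parts_subset[OF M] \<open>finite L\<close>] sub_partition[OF M]
      by (intro ext prod.partition[symmetric])
    finally show "(\<Prod>M'\<in>sub M. ?E (G M')) \<le> ?E (G M)" .
  qed
  also have "\<dots> = measure_pmf.expectation (turnout_pmf H p \<pi>) (\<lambda>\<omega>. \<Prod>l\<in>L. g l (voters H \<pi> \<omega> l))"
    unfolding G_def using \<open>finite H\<close> \<open>finite L\<close> part nonneg by (rule expectation_schedule[symmetric])
  finally show ?thesis .
qed

theorem theoremB:
  fixes H :: "'v set" and T :: "'p set" and L :: "'e set"
    and p :: "'v \<Rightarrow> real" and t :: "'v \<Rightarrow> 'p"
    and W :: "'e \<Rightarrow> 'v set \<Rightarrow> 'p set pmf"
    and \<pi> \<pi>' :: "'e set set"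
  assumes "finite H" and "finite T" and "finite L" and "L \<noteq> {}"
    and "\<And>h. h \<in> H \<Longrightarrow> 0 \<le> p h \<and> p h \<le> 1"
    and "\<And>h. h \<in> H \<Longrightarrow> t h \<in> T"
    and winners_are_parties:
      "\<And>l S A. l \<in> L \<Longrightarrow> S \<subseteq> H \<Longrightarrow> A \<in> set_pmf (W l S) \<Longrightarrow> A \<subseteq> T"
    and at_most_one_winner:
      "\<And>l S A. l \<in> L \<Longrightarrow> S \<subseteq> H \<Longrightarrow> A \<in> set_pmf (W l S) \<Longrightarrow> card A \<le> 1"
    and extra_vote_own:
      "\<And>l S h. l \<in> L \<Longrightarrow> S \<subseteq> H \<Longrightarrow> h \<in> H \<Longrightarrow>
         win_prob W l (t h) (insert h S) \<ge> win_prob W l (t h) S"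
    and extra_vote_rival:
      "\<And>l S h s. l \<in> L \<Longrightarrow> S \<subseteq> H \<Longrightarrow> h \<in> H \<Longrightarrow> s \<in> T \<Longrightarrow> s \<noteq> t h \<Longrightarrow>
         win_prob W l s (insert h S) \<le> win_prob W l s S"
    and "partition_on L \<pi>" and "partition_on L \<pi>'"
    and "coarser_schedule L \<pi> \<pi>'"
  shows "sweep_prob H T L p W \<pi> \<ge> sweep_prob H T L p W \<pi>'"
proof -
  have "measure_pmf.expectation (turnout_pmf H p \<pi>') (\<lambda>\<omega>. \<Prod>l\<in>L. win_prob W l s (voters H \<pi>' \<omega> l))
      \<le> measure_pmf.expectation (turnout_pmf H p \<pi>) (\<lambda>\<omega>. \<Prod>l\<in>L. win_prob W l s (voters H \<pi> \<omega> l))"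
    if s: "s \<in> T" for s
  proof -
    \<comment> \<open>Turnout is favourable to \<open>s\<close> for supporters of \<open>s\<close> and unfavourable for all other voters.\<close>
    define le where "le h a b = (if t h = s then a \<le> b else b \<le> a)" for h and a b :: bool
    have "coordinatewise_mono H le (\<lambda>x. win_prob W l s {h \<in> H. x h})" if l: "l \<in> L" for l
      unfolding coordinatewise_mono_def
    proof (intro allI ballI impI)
      fix x h a b
      assume h: "h \<in> H" and le: "le h a b"
      define S where "S = {k \<in> H. k \<noteq> h \<and> x k}"
      have S: "S \<subseteq> H" by (auto simp: S_def)
      have upd: "{k \<in> H. (x(h := c)) k} = (if c then insert h S else S)" for c
        using h by (auto simp: S_def)
      show "win_prob W l s {k \<in> H. (x(h := a)) k} \<le> win_prob W l s {k \<in> H. (x(h := b)) k}"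
        unfolding upd
        using le extra_vote_own[OF l S h] extra_vote_rival[OF l S h s]
        by (auto simp: le_def split: if_splits)
    qed
    then show ?thesis
      using assms(1,3,11-13)
      by (intro expectation_coarser_schedule[where le = le]) (auto simp: win_prob_def le_def)
  qed
  then have "(\<Sum>s\<in>T. measure_pmf.expectation (turnout_pmf H p \<pi>')
        (\<lambda>\<omega>. \<Prod>l\<in>L. win_prob W l s (voters H \<pi>' \<omega> l)))
      \<le> (\<Sum>s\<in>T. measure_pmf.expectation (turnout_pmf H p \<pi>)
        (\<lambda>\<omega>. \<Prod>l\<in>L. win_prob W l s (voters H \<pi> \<omega> l)))"
    by (rule sum_mono)
  moreover have "sweep_prob H T L p W \<rho> = (\<Sum>s\<in>T. measure_pmf.expectation (turnout_pmf H p \<rho>)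
        (\<lambda>\<omega>. \<Prod>l\<in>L. win_prob W l s (voters H \<rho> \<omega> l)))" for \<rho>
    using assms(2-4) winners_are_parties at_most_one_winner by (rule sweep_prob_eq_sum_expectation)
  ultimately show ?thesis
    by simp
qed

end
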